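(* Let $n\in\mathbb{N}_0$. Let $N$ be an even positive integer, let $x_i:=i/N$ for $i=0,1,\dots,N$, and let $$X_{2j-1}:=X_{2j}:=\Bigl[\tfrac{2(j-1)}{N},\tfrac{2j}{N}\Bigr],\quad j=1,\dots,N/2 .$$ Let $u_i:X_i\to[0,1]$ be the affine maps $u_{2j-1}(x)=\frac{x}{2}+\frac{j-1}{N}$ and $u_{2j}(x)=\frac{x}{2}+\frac{j}{N}$, so that $u_i(X_i)=[\frac{i-1}{N},\frac{i}{N}]$, $i=1,\dots,N$. For $j=0,1,\dots,N/2$ let $\mathbf{y}_j^{(n)}=(y_j^{(0)},\dots,y_j^{(n)})^T\in\mathbb{R}^{n+1}$ be given, let $\mathscr{I}^{(n)}:=\{(x_{2j},\mathbf{y}_j^{(n)}): j=0,\dots,N/2\}$, and let $$C^n_{\mathscr{I}^{(n)}}:=\{f\in C^n[0,1] : D^kf(x_{2j})=y_j^{(k)},\ k=0,\dots,n,\ j=0,\dots,N/2\}.$$ Let $\lambda_i,S_i\in C^n(X_i)$, $i=1,\dots,N$, and let $\Phi$ be given by $$(\Phi f)(u_i(x))=\lambda_i(x)+S_i(x)f(x),\qquad x\in X_i,\ i=1,\dots,N.$$ Assume that, for all $f\in C^n_{\mathscr{I}^{(n)}}$, all $k=0,1,\dots,n$ and all $j=1,\dots,N/2$, $$y_{j-1}^{(k)}=D^k\Phi f(x_{2(j-1)}+),\qquad y_j^{(k)}=D^k\Phi f(x_{2j}-),\qquad D^k\Phi f(x_{2j-1}-)=D^k\Phi f(x_{2j-1}+).$$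 Then $\Phi$ maps $C^n_{\mathscr{I}^{(n)}}$ into itself and is well defined. Furthermore, if $$2^n\max_{i=1,\dots,N}\ \max_{k=0,1,\dots,n}\Bigl\{\sum_{l=0}^k\binom{n-k+l}{l}\|D^lS_i\|_{\infty,X_i}\Bigr\}<1,$$ then $\Phi$ is contractive on $C^n_{\mathscr{I}^{(n)}}$ and has a unique fixed point $\mathfrak{f}\in C^n_{\mathscr{I}^{(n)}}$.
   Context: $C^n(\Omega)$ is the space of real-valued functions on $\Omega$ with continuous derivatives $D^kf$ up to order $n$ (one-sided at endpoints of closed intervals), with norm $\|f\|_{C^n(\Omega)}:=\sum_{k=0}^n\|D^kf\|_{\infty,\Omega}$, where $\|\cdot\|_{\infty,\Omega}$ is the supremum norm on $\Omega$; $C^n_{\mathscr{I}^{(n)}}$ carries the metric induced by $\|\cdot\|_{C^n[0,1]}$. For a knot $x_m$, $D^k\Phi f(x_m-)$ denotes the left-hand value at $x_m$ of the $k$-th derivative of the piece of $\Phi f$ on $u_m(X_m)=[x_{m-1},x_m]$, and $D^k\Phi f(x_m+)$ the right-hand value at $x_m$ of the $k$-th derivative of the piece on $u_{m+1}(X_{m+1})=[x_m,x_{m+1}]$, each piece being given by the defining formula for $\Phi f$ on that interval. "Contractive" means Lipschitz with a constant $c\in[0,1)$. *)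

theory Defs
  imports "HOL-Analysis.Analysis"
begin

text \<open>Iterated derivative relative to \<open>\<Omega>\<close>; at an endpoint of a closed interval
  the derivative within \<open>\<Omega>\<close> is the one-sided one.\<close>

primrec deriv_within :: "real set \<Rightarrow> nat \<Rightarrow> (real \<Rightarrow> real) \<Rightarrow> real \<Rightarrow> real" where
  "deriv_within \<Omega> 0 f = f"
| "deriv_within \<Omega> (Suc k) f = (\<lambda>x. vector_derivative (deriv_within \<Omega> k f) (at x within \<Omega>))"

text \<open>A function on \<open>\<Omega>\<close> is represented by the HOL function that is \<open>undefined\<close> off \<open>\<Omega>\<close>,
  so that equality of representatives is equality on \<open>\<Omega>\<close>.\<close>

definition Cn :: "nat \<Rightarrow> real set \<Rightarrow> (real \<Rightarrow> real) set" where
  "Cn n \<Omega> = {f \<in> extensional \<Omega>.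
     (\<forall>k<n. deriv_within \<Omega> k f differentiable_on \<Omega>) \<and>
     (\<forall>k\<le>n. continuous_on \<Omega> (deriv_within \<Omega> k f))}"

definition sup_norm :: "real set \<Rightarrow> (real \<Rightarrow> real) \<Rightarrow> real" where
  "sup_norm \<Omega> f = (SUP x\<in>\<Omega>. \<bar>f x\<bar>)"

definition Cn_norm :: "nat \<Rightarrow> real set \<Rightarrow> (real \<Rightarrow> real) \<Rightarrow> real" where
  "Cn_norm n \<Omega> f = (\<Sum>k\<le>n. sup_norm \<Omega> (deriv_within \<Omega> k f))"

definition Cn_dist :: "nat \<Rightarrow> real set \<Rightarrow> (real \<Rightarrow> real) \<Rightarrow> (real \<Rightarrow> real) \<Rightarrow> real" where
  "Cn_dist n \<Omega> f g = Cn_norm n \<Omega> (\<lambda>x. f x - g x)"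

definition contractive_on :: "'a set \<Rightarrow> ('a \<Rightarrow> 'a \<Rightarrow> real) \<Rightarrow> ('a \<Rightarrow> 'a) \<Rightarrow> bool" where
  "contractive_on M d T \<longleftrightarrow> (\<exists>c. 0 \<le> c \<and> c < 1 \<and> (\<forall>f\<in>M. \<forall>g\<in>M. d (T f) (T g) \<le> c * d f g))"

definition knot :: "nat \<Rightarrow> nat \<Rightarrow> real" where
  "knot N i = real i / real N"

text \<open>For both \<open>i = 2 * j - 1\<close> and \<open>i = 2 * j\<close> one has \<open>j = (i + 1) div 2\<close>.\<close>

definition X :: "nat \<Rightarrow> nat \<Rightarrow> real set" where
  "X N i = (let j = (i + 1) div 2 in {2 * (real j - 1) / real N .. 2 * real j / real N})"

definition u :: "nat \<Rightarrow> nat \<Rightarrow> real \<Rightarrow> real" where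
  "u N i x = (let j = (i + 1) div 2 in
     if odd i then x / 2 + (real j - 1) / real N else x / 2 + real j / real N)"

lemma X_odd: "j \<ge> 1 \<Longrightarrow> X N (2 * j - 1) = {2 * (real j - 1) / real N .. 2 * real j / real N}"
  and X_even: "X N (2 * j) = {2 * (real j - 1) / real N .. 2 * real j / real N}"
  by (simp_all add: X_def)

lemma u_odd: "j \<ge> 1 \<Longrightarrow> u N (2 * j - 1) x = x / 2 + (real j - 1) / real N"
  and u_even: "u N (2 * j) x = x / 2 + real j / real N"
  by (simp_all add: u_def)

lemma u_image_X:
  assumes "N > 0" "i \<ge> 1"
  shows "u N i ` X N i = {knot N (i - 1) .. knot N i}"
proof -
  have img: "(\<lambda>x. x / 2 + c) ` {a..b} = {a / 2 + c .. b / 2 + c}" if "a \<le> b" for a b c :: real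
    using image_affinity_atLeastAtMost[of "1/2" c a b] that by (simp add: field_simps)
  show ?thesis
  proof (cases "odd i")
    case True
    then obtain j where i: "i = 2 * j + 1" by (elim oddE)
    have "u N i = (\<lambda>x. x / 2 + real j / real N)"
      "X N i = {2 * real j / real N .. 2 * (real j + 1) / real N}"
      by (auto simp: u_def X_def i)
    then show ?thesis
      using assms(1) by (simp add: img divide_right_mono i knot_def add_divide_distrib)
  next
    case False
    then obtain j where i: "i = 2 * j" by blast
    have "u N i = (\<lambda>x. x / 2 + real j / real N)"
      "X N i = {2 * (real j - 1) / real N .. 2 * real j / real N}"
      by (auto simp: u_def X_def i)
    then show ?thesis
      using assms by (simp add: img divide_right_mono i knot_def add_divide_distrib diff_divide_distrib of_nat_diff)
  qed
qed

text \<open>The data vectors are given by \<open>y j k\<close>, the prescribed \<open>k\<close>-th derivative at the knot \<open>2 * j\<close>.\<close>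

definition Cn_interp :: "nat \<Rightarrow> nat \<Rightarrow> (nat \<Rightarrow> nat \<Rightarrow> real) \<Rightarrow> (real \<Rightarrow> real) set" where
  "Cn_interp n N y = {f \<in> Cn n {0..1}.
     \<forall>k\<le>n. \<forall>j\<le>N div 2. deriv_within {0..1} k f (knot N (2 * j)) = y j k}"

text \<open>The defining equations of \<open>\<Phi> f = g\<close>. Existence and uniqueness of \<open>g\<close> is the
  well-definedness of \<open>\<Phi>\<close>: the pieces overlap at the interior knots.\<close>

definition Phi_eq ::
  "nat \<Rightarrow> (nat \<Rightarrow> real \<Rightarrow> real) \<Rightarrow> (nat \<Rightarrow> real \<Rightarrow> real) \<Rightarrow> (real \<Rightarrow> real) \<Rightarrow> (real \<Rightarrow> real) \<Rightarrow> bool" where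
  "Phi_eq N lam S f g \<longleftrightarrow> g \<in> extensional {0..1} \<and>
     (\<forall>i\<in>{1..N}. \<forall>x\<in>X N i. g (u N i x) = lam i x + S i x * f x)"

definition Phi ::
  "nat \<Rightarrow> (nat \<Rightarrow> real \<Rightarrow> real) \<Rightarrow> (nat \<Rightarrow> real \<Rightarrow> real) \<Rightarrow> (real \<Rightarrow> real) \<Rightarrow> real \<Rightarrow> real" where
  "Phi N lam S f = (THE g. Phi_eq N lam S f g)"

definition Phi_piece ::
  "nat \<Rightarrow> (nat \<Rightarrow> real \<Rightarrow> real) \<Rightarrow> (nat \<Rightarrow> real \<Rightarrow> real) \<Rightarrow> (real \<Rightarrow> real) \<Rightarrow> nat \<Rightarrow> real \<Rightarrow> real" where
  "Phi_piece N lam S f i t = (let x = inv_into (X N i) (u N i) t in lam i x + S i x * f x)"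

text \<open>The one-sided values at the \<open>m\<close>-th knot of the \<open>k\<close>-th derivative of the pieces to its left
  and to its right; they are meaningful without \<open>\<Phi> f\<close> being well defined.\<close>

definition DPhi_left ::
  "nat \<Rightarrow> (nat \<Rightarrow> real \<Rightarrow> real) \<Rightarrow> (nat \<Rightarrow> real \<Rightarrow> real) \<Rightarrow> nat \<Rightarrow> (real \<Rightarrow> real) \<Rightarrow> nat \<Rightarrow> real" where
  "DPhi_left N lam S k f m =
     deriv_within (u N m ` X N m) k (Phi_piece N lam S f m) (knot N m)"

definition DPhi_right ::
  "nat \<Rightarrow> (nat \<Rightarrow> real \<Rightarrow> real) \<Rightarrow> (nat \<Rightarrow> real \<Rightarrow> real) \<Rightarrow> nat \<Rightarrow> (real \<Rightarrow> real) \<Rightarrow> nat \<Rightarrow> real" where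
  "DPhi_right N lam S k f m =
     deriv_within (u N (m + 1) ` X N (m + 1)) k (Phi_piece N lam S f (m + 1)) (knot N m)"

end

theory Submission
  imports Defs
begin

text \<open>On the \<open>i\<close>-th piece \<open>\<Phi> f\<close> is \<open>lam i + S i * f\<close> composed with an affine map of slope
  \<open>2\<close>, so its \<open>k\<close>-th derivative there is \<open>2 ^ k\<close> times a Leibniz sum (\<open>Phi_piece_jet\<close>). The
  hypotheses say that these derivatives agree at every interior knot for all \<open>k \<le> n\<close>, and a
  function whose one-sided derivatives agree at a knot is differentiable there; hence the pieces
  form one \<open>C\<^sup>n\<close> function (\<open>Phi_glue\<close>), which takes the prescribed values at the even knots.

  Let \<open>h = f - g\<close> for interpolants \<open>f\<close>, \<open>g\<close>, let \<open>H k\<close> be the supremum norm of its \<open>k\<close>-th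
  derivative, and let \<open>a i l\<close> be that of the \<open>l\<close>-th derivative of \<open>S i\<close>. The \<open>k\<close>-th derivative of
  \<open>\<Phi> f - \<Phi> g\<close> is at most the maximum over \<open>i\<close> of \<open>2 ^ k * (\<Sum>l\<le>k. (k choose l) * a i l * H (k - l))\<close>.
  After \<open>2 ^ k \<le> 2 ^ n\<close>, summing over \<open>k\<close> and collecting the coefficient of each \<open>H m\<close> would produce exactly the sums in
  the hypothesis, were it not that the maximising \<open>i\<close> varies with \<open>k\<close>, so that one such coefficient
  mixes different pieces. The proof therefore bounds each \<open>k\<close> separately, by \<open>q * H k\<close> with \<open>q\<close> the
  left-hand side of the smallness condition. Two facts make this possible. Since
  \<open>h\<close> and its derivatives vanish at \<open>0\<close> and \<open>1\<close>, and every point of \<open>[0,1]\<close> is within \<open>1/2\<close> of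
  one of them, \<open>H (k - l) \<le> H k / 2 ^ l\<close> (\<open>halving_by_endpoint_zeros\<close>). And averaging the \<open>n + 1\<close>
  bounds that the hypothesis gives for a fixed \<open>i\<close> yields, by the hockey-stick identity,
  \<open>2 ^ n * (\<Sum>l\<le>n. (n choose l) / (l + 1) * a i l) \<le> q\<close> (\<open>weighted_average_bound\<close>). As
  \<open>l + 1 \<le> 2 ^ l\<close>, the two combine to the wanted estimate (\<open>leibniz_contraction\<close>).

  The fixed point comes from Banach's theorem: the interpolants are a complete metric space, being
  closed in \<open>C\<^sup>n\<close> (\<open>Cn_contraction_fixed_point\<close>), and there is at least one, namely a Hermite
  interpolation polynomial (\<open>Cn_interp_nonempty\<close>).\<close>

section \<open>Jets\<close>

text \<open>A jet lists a function together with its derivatives up to order \<open>n\<close>. Explicit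
  derivatives are far easier to add, multiply, rescale and join than \<open>deriv_within\<close>, which makes
  sense only relative to one set; \<open>deriv_within_jet\<close> and \<open>Cn_eq_jet_on\<close> translate between the two.\<close>

definition jet_on :: "nat \<Rightarrow> real set \<Rightarrow> (nat \<Rightarrow> real \<Rightarrow> real) \<Rightarrow> bool" where
  "jet_on n \<Omega> D \<longleftrightarrow>
     (\<forall>k<n. \<forall>x\<in>\<Omega>. (D k has_real_derivative D (Suc k) x) (at x within \<Omega>)) \<and>
     continuous_on \<Omega> (D n)"

lemma jet_on_deriv:
  "\<lbrakk>jet_on n \<Omega> D; k < n; x \<in> \<Omega>\<rbrakk> \<Longrightarrow> (D k has_real_derivative D (Suc k) x) (at x within \<Omega>)"
  by (simp add: jet_on_def)

lemma jet_on_continuous: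
  assumes "jet_on n \<Omega> D" "k \<le> n"
  shows "continuous_on \<Omega> (D k)"
proof (cases "k = n")
  case True
  then show ?thesis using assms by (simp add: jet_on_def)
next
  case False
  then show ?thesis
    using assms by (intro DERIV_continuous_on[of \<Omega> "D k" "D (Suc k)"]) (simp add: jet_on_def)
qed

lemma jet_on_subset:
  assumes "jet_on n \<Omega> D" "T \<subseteq> \<Omega>"
  shows "jet_on n T D"
  using assms unfolding jet_on_def
  by (auto intro: DERIV_subset continuous_on_subset)

lemma jet_on_cong:
  assumes "jet_on n \<Omega> D" and eq: "\<And>k x. \<lbrakk>k \<le> n; x \<in> \<Omega>\<rbrakk> \<Longrightarrow> D k x = E k x"
  shows "jet_on n \<Omega> E"
proof -
  have "(E k has_real_derivative E (Suc k) x) (at x within \<Omega>)" if "k < n" "x \<in> \<Omega>" for k x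
    using jet_on_deriv[OF assms(1) that] that eq
    by (intro has_field_derivative_transform_within[of "D k" _ x \<Omega> 1 "E k"]) auto
  moreover have "continuous_on \<Omega> (E n)"
    using jet_on_continuous[OF assms(1) order_refl] eq by (simp cong: continuous_on_cong)
  ultimately show ?thesis by (simp add: jet_on_def)
qed

text \<open>Nondegeneracy \<open>a < b\<close> makes derivatives within the interval unique, so by induction any
  jet of \<open>f\<close> consists of the iterated derivatives of \<open>f\<close>.\<close>

lemma deriv_within_jet:
  assumes "jet_on n {a..b} D" "a < b" "\<And>x. x \<in> {a..b} \<Longrightarrow> f x = D 0 x" "k \<le> n" "x \<in> {a..b}"
  shows "deriv_within {a..b} k f x = D k x"
  using assms(4,5)
proof (induction k arbitrary: x)
  case 0
  then show ?case using assms(3) by simp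
next
  case (Suc k)
  have "(D k has_real_derivative D (Suc k) x) (at x within {a..b})"
    using assms(1) Suc.prems by (simp add: jet_on_deriv)
  then have "(deriv_within {a..b} k f has_real_derivative D (Suc k) x) (at x within {a..b})"
    by (rule has_field_derivative_transform_within[where d = 1])
      (use Suc.IH Suc.prems in auto)
  then show ?case
    using Suc.prems assms(2)
    by (simp add: vector_derivative_within_closed_interval has_real_derivative_iff_has_vector_derivative)
qed

lemma Cn_eq_jet_on:
  "Cn n \<Omega> = {f \<in> extensional \<Omega>. jet_on n \<Omega> (\<lambda>k. deriv_within \<Omega> k f)}"
proof (rule set_eqI)
  fix f
  let ?D = "\<lambda>k. deriv_within \<Omega> k f"
  have *: "?D k differentiable_on \<Omega> \<longleftrightarrow>
      (\<forall>x\<in>\<Omega>. (?D k has_real_derivative ?D (Suc k) x) (at x within \<Omega>))" for k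
    by (auto simp: differentiable_on_def has_real_derivative_iff_has_vector_derivative
        vector_derivative_works differentiable_def has_vector_derivative_def)
  show "f \<in> Cn n \<Omega> \<longleftrightarrow> f \<in> {g \<in> extensional \<Omega>. jet_on n \<Omega> (\<lambda>k. deriv_within \<Omega> k g)}"
    unfolding Cn_def mem_Collect_eq *
    using jet_on_continuous[of n \<Omega> ?D] by (auto simp: jet_on_def)
qed

lemma Cn_imp_jet_on: "f \<in> Cn n \<Omega> \<Longrightarrow> jet_on n \<Omega> (\<lambda>k. deriv_within \<Omega> k f)"
  by (simp add: Cn_eq_jet_on)

lemma jet_on_imp_Cn:
  assumes "jet_on n {a..b} D" "a < b" "\<And>x. x \<in> {a..b} \<Longrightarrow> f x = D 0 x" "f \<in> extensional {a..b}"
  shows "f \<in> Cn n {a..b}"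
proof -
  have "jet_on n {a..b} (\<lambda>k. deriv_within {a..b} k f)"
    by (rule jet_on_cong[OF assms(1)]) (use deriv_within_jet[OF assms(1-3)] in auto)
  then show ?thesis using assms(4) by (simp add: Cn_eq_jet_on)
qed

lemma jet_on_add:
  assumes "jet_on n \<Omega> D" "jet_on n \<Omega> E"
  shows "jet_on n \<Omega> (\<lambda>k x. D k x + E k x)"
  using assms by (simp add: jet_on_def DERIV_add continuous_on_add)

lemma jet_on_diff:
  assumes "jet_on n \<Omega> D" "jet_on n \<Omega> E"
  shows "jet_on n \<Omega> (\<lambda>k x. D k x - E k x)"
  using assms by (simp add: jet_on_def DERIV_diff continuous_on_diff)

definition leibniz :: "(nat \<Rightarrow> real \<Rightarrow> real) \<Rightarrow> (nat \<Rightarrow> real \<Rightarrow> real) \<Rightarrow> nat \<Rightarrow> real \<Rightarrow> real" where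
  "leibniz D E k x = (\<Sum>l\<le>k. real (k choose l) * D l x * E (k - l) x)"

text \<open>Pascal's rule: differentiating each product in the Leibniz sum of order \<open>k\<close> gives the Leibniz
  sum of order \<open>k + 1\<close>.\<close>

lemma leibniz_Suc:
  fixes A B :: "nat \<Rightarrow> real"
  shows "(\<Sum>l\<le>k. real (k choose l) * (A (Suc l) * B (k - l) + A l * B (Suc (k - l))))
       = (\<Sum>l\<le>Suc k. real (Suc k choose l) * A l * B (Suc k - l))"
proof -
  have "(\<Sum>l\<le>Suc k. real (Suc k choose l) * A l * B (Suc k - l))
      = A 0 * B (Suc k) + (\<Sum>l\<le>k. real (k choose l) * A (Suc l) * B (k - l))
        + (\<Sum>l\<le>k. real (k choose Suc l) * A (Suc l) * B (k - l))"
    by (simp add: sum.atMost_Suc_shift algebra_simps sum.distrib del: sum.atMost_Suc)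
  also have "A 0 * B (Suc k) + (\<Sum>l\<le>k. real (k choose l) * A (Suc l) * B (k - l))
        + (\<Sum>l\<le>k. real (k choose Suc l) * A (Suc l) * B (k - l))
      = (\<Sum>l\<le>k. real (k choose l) * A (Suc l) * B (k - l))
        + (\<Sum>l\<le>Suc k. real (k choose l) * A l * B (Suc k - l))"
    by (simp add: sum.atMost_Suc_shift del: sum.atMost_Suc)
  also have "(\<Sum>l\<le>Suc k. real (k choose l) * A l * B (Suc k - l))
      = (\<Sum>l\<le>k. real (k choose l) * A l * B (Suc (k - l)))"
    by (simp add: Suc_diff_le)
  finally show ?thesis
    by (simp add: sum.distrib algebra_simps)
qed

lemma jet_on_mult:
  assumes "jet_on n \<Omega> D" "jet_on n \<Omega> E"
  shows "jet_on n \<Omega> (leibniz D E)"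
proof -
  have "(leibniz D E k has_real_derivative leibniz D E (Suc k) x) (at x within \<Omega>)"
    if "k < n" "x \<in> \<Omega>" for k x
  proof -
    have "((\<lambda>x. \<Sum>l\<le>k. real (k choose l) * (D l x * E (k - l) x)) has_real_derivative
        (\<Sum>l\<le>k. real (k choose l) * (D (Suc l) x * E (k - l) x + D l x * E (Suc (k - l)) x)))
        (at x within \<Omega>)"
    proof (intro DERIV_sum DERIV_cmult)
      fix l assume "l \<in> {..k}"
      then have "(D l has_real_derivative D (Suc l) x) (at x within \<Omega>)"
        "(E (k - l) has_real_derivative E (Suc (k - l)) x) (at x within \<Omega>)"
        using assms that by (auto intro!: jet_on_deriv)
      then show "((\<lambda>x. D l x * E (k - l) x) has_real_derivative
          D (Suc l) x * E (k - l) x + D l x * E (Suc (k - l)) x) (at x within \<Omega>)"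
        by (auto intro!: derivative_eq_intros)
    qed
    then show ?thesis
      unfolding leibniz_Suc[of k "\<lambda>l. D l x" "\<lambda>l. E l x"] leibniz_def[abs_def]
      by (simp only: mult.assoc)
  qed
  moreover have "continuous_on \<Omega> (leibniz D E n)"
    unfolding leibniz_def[abs_def] using assms
    by (intro continuous_intros) (auto intro: jet_on_continuous)
  ultimately show ?thesis by (simp add: jet_on_def)
qed

lemma jet_on_affine:
  fixes c :: real
  assumes "jet_on n \<Omega> D" "\<And>t. t \<in> T \<Longrightarrow> c * t + d \<in> \<Omega>"
  shows "jet_on n T (\<lambda>k t. c ^ k * D k (c * t + d))"
proof -
  have "((\<lambda>t. c ^ k * D k (c * t + d)) has_real_derivative c ^ Suc k * D (Suc k) (c * t + d)) (at t within T)"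
    if "k < n" "t \<in> T" for k t
  proof -
    have "(D k has_real_derivative D (Suc k) (c * t + d)) (at (c * t + d) within ((\<lambda>t. c * t + d) ` T))"
      using that assms by (auto intro!: DERIV_subset[OF jet_on_deriv[OF assms(1)]])
    moreover have "((\<lambda>t. c * t + d) has_real_derivative c) (at t within T)"
      by (auto intro!: derivative_eq_intros)
    ultimately have "(D k \<circ> (\<lambda>t. c * t + d) has_real_derivative D (Suc k) (c * t + d) * c) (at t within T)"
      by (rule DERIV_image_chain)
    from DERIV_cmult[OF this, of "c ^ k"] show ?thesis
      by (simp add: o_def mult_ac)
  qed
  moreover have "continuous_on T (\<lambda>t. D n (c * t + d))"
    using assms
    by (intro continuous_on_compose2[OF jet_on_continuous[OF assms(1) order_refl]])
      (auto intro!: continuous_intros)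
  ultimately show ?thesis
    by (simp add: jet_on_def continuous_on_mult_left)
qed

text \<open>A difference quotient converges within a union of two sets once it converges within each. No
  matching condition at \<open>b\<close> appears because both hypotheses speak of the same \<open>D\<close>; for pieces
  that agree at the knots such a \<open>D\<close> is supplied by \<open>glue_pieces\<close>.\<close>

lemma jet_on_join:
  assumes "jet_on n {a..b} D" "jet_on n {b..c} D" "a \<le> b" "b \<le> c"
  shows "jet_on n {a..c} D"
proof -
  have U: "{a..c} = {a..b} \<union> {b..c}" using assms by auto
  \<comment> \<open>off a closed interval the punctured neighbourhood filter within it is trivial\<close>
  have ext: "(D k has_real_derivative D (Suc k) x) (at x within {p..q})"
    if "jet_on n {p..q} D" "k < n" for k x p q
  proof (cases "x \<in> {p..q}")
    case False
    then have "at x within {p..q} = bot"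
      by (metis closed_atLeastAtMost closed_limpt trivial_limit_within trivial_limit_def)
    then show ?thesis by (simp add: has_field_derivative_iff)
  qed (use that jet_on_deriv in blast)
  have "(D k has_real_derivative D (Suc k) x) (at x within {a..c})" if "k < n" for k x
    using ext[OF assms(1) that, of x] ext[OF assms(2) that, of x]
    unfolding U has_field_derivative_iff by (rule Lim_Un)
  moreover have "continuous_on {a..c} (D n)"
    unfolding U using assms by (intro continuous_on_closed_Un jet_on_continuous[OF _ order_refl]) auto
  ultimately show ?thesis by (simp add: jet_on_def)
qed

lemma jet_on_join_many:
  fixes p :: "nat \<Rightarrow> real"
  assumes "mono p" "M > 0" "\<And>i. i \<in> {1..M} \<Longrightarrow> jet_on n {p (i - 1)..p i} D"
  shows "jet_on n {p 0..p M} D"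
  using assms(2,3)
proof (induction M rule: nat_induct_non_zero)
  case 1
  then show ?case using "1.prems"[of 1] by simp
next
  case (Suc M)
  have "jet_on n {p 0..p M} D" "jet_on n {p M..p (Suc M)} D"
    using Suc.IH Suc.prems[of "Suc M"] Suc.prems by auto
  then show ?case
    by (rule jet_on_join) (use assms(1) in \<open>auto intro: monoD\<close>)
qed

lemma glue_pieces:
  fixes p :: "nat \<Rightarrow> real" and E :: "nat \<Rightarrow> real \<Rightarrow> 'b"
  assumes "mono p" "\<And>m. \<lbrakk>1 \<le> m; m < M\<rbrakk> \<Longrightarrow> E m (p m) = E (Suc m) (p m)"
  shows "\<exists>g. \<forall>i\<in>{1..M}. \<forall>t\<in>{p (i - 1)..p i}. g t = E i t"
  using assms(2)
proof (induction M)
  case 0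
  then show ?case by auto
next
  case (Suc M)
  then obtain g where g: "\<forall>i\<in>{1..M}. \<forall>t\<in>{p (i - 1)..p i}. g t = E i t" by auto
  let ?h = "\<lambda>t. if M \<ge> 1 \<and> t \<le> p M then g t else E (Suc M) t"
  have "?h t = E i t" if i: "i \<in> {1..Suc M}" and t: "t \<in> {p (i - 1)..p i}" for i t
  proof (cases "i = Suc M")
    case True
    show ?thesis
    proof (cases "M \<ge> 1 \<and> t \<le> p M")
      case True
      then have "t = p M" using t \<open>i = Suc M\<close> by auto
      moreover have "p (M - 1) \<le> p M" using assms(1) by (auto intro: monoD)
      ultimately have "g t = E M t" using True g by auto
      then show ?thesis using True \<open>t = p M\<close> Suc.prems[of M] \<open>i = Suc M\<close> by simp
    qed (use True in auto)
  next
    case False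
    then have "p i \<le> p M" using i assms(1) by (auto intro: monoD)
    then show ?thesis using False i t g by auto
  qed
  then show ?case by (intro exI[of _ ?h] ballI)
qed

section \<open>Hermite interpolation\<close>

text \<open>Differentiating \<open>(x - a) ^ m * R\<close> gives \<open>(x - a) ^ (m - 1) * (m * R + (x - a) * R')\<close>, again of
  the same shape with a cofactor that takes the value \<open>m * R(a)\<close> at \<open>a\<close>.\<close>

lemma poly_higher_pderiv_root_power:
  fixes R :: "'a::{idom,semiring_char_0} poly"
  shows "k \<le> m \<Longrightarrow> poly ((pderiv ^^ k) ([:-a, 1:] ^ m * R)) a = (if k = m then fact m * poly R a else 0)"
proof (induction k arbitrary: m R)
  case 0
  then show ?case by (simp add: poly_power)
next
  case (Suc k)
  then obtain m' where m: "m = Suc m'" by (cases m) auto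
  have "pderiv ([:-a, 1:] ^ m * R) = [:-a, 1:] ^ m' * (smult (of_nat m) R + [:-a, 1:] * pderiv R)"
    unfolding m pderiv_mult pderiv_power_Suc
    by (simp add: pderiv_pCons algebra_simps flip: one_pCons del: mult_pCons_left mult_pCons_right)
  then have "(pderiv ^^ Suc k) ([:-a, 1:] ^ m * R)
      = (pderiv ^^ k) ([:-a, 1:] ^ m' * (smult (of_nat m) R + [:-a, 1:] * pderiv R))"
    by (simp only: funpow_Suc_right o_apply)
  then have "poly ((pderiv ^^ Suc k) ([:-a, 1:] ^ m * R)) a
      = (if k = m' then fact m' * poly (smult (of_nat m) R + [:-a, 1:] * pderiv R) a else 0)"
    using Suc.IH[of m'] Suc.prems m by (simp only: Suc_le_mono)
  then show ?case
    by (simp add: m algebra_simps)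
qed

text \<open>To prescribe the \<open>r\<close>-th derivative at a new node \<open>p M\<close> one adds a multiple of
  \<open>(x - p M) ^ r * W\<close>, where \<open>W\<close> vanishes to order \<open>m\<close> at the old nodes: this disturbs neither
  the old nodes nor the lower derivatives at the new one.\<close>

lemma hermite_interpolation:
  fixes p :: "nat \<Rightarrow> real"
  assumes "inj p"
  shows "\<exists>P. \<forall>j<M. \<forall>k<m. poly ((pderiv ^^ k) P) (p j) = y j k"
proof (induction M)
  case 0
  then show ?case by simp
next
  case (Suc M)
  \<comment> \<open>the conditions at the new node are met one derivative at a time\<close>
  have "\<exists>P. (\<forall>j<M. \<forall>k<m. poly ((pderiv ^^ k) P) (p j) = y j k) \<and>
    (\<forall>k<r. poly ((pderiv ^^ k) P) (p M) = y M k)" for r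
  proof (induction r)
    case 0
    then show ?case using Suc.IH by simp
  next
    case (Suc r)
    then obtain P where P: "\<And>j k. \<lbrakk>j < M; k < m\<rbrakk> \<Longrightarrow> poly ((pderiv ^^ k) P) (p j) = y j k"
      "\<And>k. k < r \<Longrightarrow> poly ((pderiv ^^ k) P) (p M) = y M k" by blast
    define W where "W = (\<Prod>j<M. [:-p j, 1:] ^ m)"
    have W: "poly W (p M) \<noteq> 0"
      using assms by (auto simp: W_def poly_prod poly_power inj_eq)
    define c where "c = (y M r - poly ((pderiv ^^ r) P) (p M)) / (fact r * poly W (p M))"
    let ?V = "[:-p M, 1:] ^ r * smult c W"
    have add: "(pderiv ^^ k) (A + B) = (pderiv ^^ k) A + (pderiv ^^ k) B" for k and A B :: "real poly"
      by (induction k) (simp_all add: pderiv_add)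
    have "poly ((pderiv ^^ k) ?V) (p j) = 0" if "j < M" "k < m" for j k
    proof -
      have "W = [:-p j, 1:] ^ m * (\<Prod>j\<in>{..<M} - {j}. [:-p j, 1:] ^ m)"
        using that by (simp add: W_def prod.remove)
      then have "?V = [:-p j, 1:] ^ m * (smult c ([:-p M, 1:] ^ r * (\<Prod>j\<in>{..<M} - {j}. [:-p j, 1:] ^ m)))"
        by (simp add: algebra_simps)
      then show ?thesis
        unfolding \<open>?V = _\<close> using poly_higher_pderiv_root_power[of k m "p j"] that
        by (simp del: mult_smult_right)
    qed
    moreover have "poly ((pderiv ^^ k) ?V) (p M) = (if k = r then y M r - poly ((pderiv ^^ r) P) (p M) else 0)"
      if "k < Suc r" for k
      using poly_higher_pderiv_root_power[of k r "p M" "smult c W"] that W by (simp add: c_def)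
    ultimately have "(\<forall>j<M. \<forall>k<m. poly ((pderiv ^^ k) (P + ?V)) (p j) = y j k) \<and>
        (\<forall>k<Suc r. poly ((pderiv ^^ k) (P + ?V)) (p M) = y M k)"
      using P by (auto simp: add less_Suc_eq)
    then show ?case by blast
  qed
  from this[of m] show ?case by (auto simp: less_Suc_eq)
qed

lemma jet_on_poly: "jet_on n \<Omega> (\<lambda>k. poly ((pderiv ^^ k) P))"
  unfolding jet_on_def
proof (intro conjI allI impI ballI)
  show "(poly ((pderiv ^^ k) P) has_real_derivative poly ((pderiv ^^ Suc k) P) x) (at x within \<Omega>)" for k x
    using has_field_derivative_at_within[OF poly_DERIV[of "(pderiv ^^ k) P" x]] by simp
  show "continuous_on \<Omega> (poly ((pderiv ^^ n) P))"
    by (intro continuous_at_imp_continuous_on ballI poly_isCont)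
qed

section \<open>Completeness\<close>

text \<open>Termwise differentiation of a uniformly convergent sequence, at each level of the jet.\<close>

lemma jet_on_uniform_limit:
  assumes "convex \<Omega>" "\<And>j. jet_on n \<Omega> (D j)"
    and lim: "\<And>k. k \<le> n \<Longrightarrow> uniform_limit \<Omega> (\<lambda>j. D j k) (G k) sequentially"
  shows "jet_on n \<Omega> G"
proof -
  have ptw: "(\<lambda>j. D j k x) \<longlonglongrightarrow> G k x" if "k \<le> n" "x \<in> \<Omega>" for k x
    using tendsto_uniform_limitI[OF lim] that by blast
  have "(G k has_real_derivative G (Suc k) x) (at x within \<Omega>)" if k: "k < n" and x: "x \<in> \<Omega>" for k x
  proof -
    have "\<exists>g. \<forall>x\<in>\<Omega>. (\<lambda>j. D j k x) \<longlonglongrightarrow> g x \<and> (g has_derivative (*) (G (Suc k) x)) (at x within \<Omega>)"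
    proof (rule has_derivative_sequence[OF assms(1) _ _ x ptw])
      show "(D j k has_derivative (*) (D j (Suc k) z)) (at z within \<Omega>)" if "z \<in> \<Omega>" for j z
        using jet_on_deriv[OF assms(2) k that] by (simp add: has_field_derivative_def)
      show "\<forall>\<^sub>F j in sequentially. \<forall>z\<in>\<Omega>. \<forall>h. norm (D j (Suc k) z * h - G (Suc k) z * h) \<le> e * norm h"
        if "e > 0" for e
      proof -
        have "\<forall>\<^sub>F j in sequentially. \<forall>z\<in>\<Omega>. dist (D j (Suc k) z) (G (Suc k) z) < e"
          using uniform_limitD[OF lim[of "Suc k"] that] k by simp
        then show ?thesis
        proof eventually_elim
          case (elim j)
          have "\<bar>D j (Suc k) z - G (Suc k) z\<bar> * \<bar>h\<bar> \<le> e * \<bar>h\<bar>" if "z \<in> \<Omega>" for z h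
            using elim that by (intro mult_right_mono) (auto simp: dist_real_def less_imp_le)
          then show ?case
            by (simp add: left_diff_distrib[symmetric] abs_mult)
        qed
      qed
    qed (use k x in auto)
    then obtain g where g: "\<forall>x\<in>\<Omega>. (\<lambda>j. D j k x) \<longlonglongrightarrow> g x \<and> (g has_derivative (*) (G (Suc k) x)) (at x within \<Omega>)"
      by blast
    have eq: "g z = G k z" if "z \<in> \<Omega>" for z
      using g ptw[of k z] that k LIMSEQ_unique by (meson less_imp_le)
    have "(g has_real_derivative G (Suc k) x) (at x within \<Omega>)"
      using g x by (simp add: has_field_derivative_def)
    then show ?thesis
      by (rule has_field_derivative_transform_within[where d = 1]) (use x eq in auto)
  qed
  moreover have "continuous_on \<Omega> (G n)"
    by (rule uniform_limit_theorem[OF _ lim]) (simp_all add: jet_on_continuous[OF assms(2)])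
  ultimately show ?thesis by (simp add: jet_on_def)
qed

lemma abs_le_sup_norm:
  assumes "compact \<Omega>" "continuous_on \<Omega> f" "x \<in> \<Omega>"
  shows "\<bar>f x\<bar> \<le> sup_norm \<Omega> f"
proof -
  have "compact ((\<lambda>x. \<bar>f x\<bar>) ` \<Omega>)"
    using assms by (intro compact_continuous_image continuous_intros)
  then show ?thesis
    unfolding sup_norm_def using assms(3)
    by (intro cSUP_upper bounded_imp_bdd_above compact_imp_bounded)
qed

lemma sup_norm_le: "\<lbrakk>\<Omega> \<noteq> {}; \<And>x. x \<in> \<Omega> \<Longrightarrow> \<bar>f x\<bar> \<le> B\<rbrakk> \<Longrightarrow> sup_norm \<Omega> f \<le> B"
  unfolding sup_norm_def by (rule cSUP_least)

lemma sup_norm_nonneg: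
  assumes "compact \<Omega>" "continuous_on \<Omega> f" "\<Omega> \<noteq> {}"
  shows "0 \<le> sup_norm \<Omega> f"
  using assms abs_le_sup_norm by (meson abs_ge_zero all_not_in_conv order_trans)

lemma Cn_deriv_continuous: "\<lbrakk>f \<in> Cn n \<Omega>; k \<le> n\<rbrakk> \<Longrightarrow> continuous_on \<Omega> (deriv_within \<Omega> k f)"
  by (simp add: Cn_def)

lemma deriv_within_diff:
  assumes "a < b" "f \<in> Cn n {a..b}" "g \<in> Cn n {a..b}" "k \<le> n" "x \<in> {a..b}"
  shows "deriv_within {a..b} k (\<lambda>x. f x - g x) x = deriv_within {a..b} k f x - deriv_within {a..b} k g x"
  using deriv_within_jet[OF jet_on_diff[OF Cn_imp_jet_on[OF assms(2)] Cn_imp_jet_on[OF assms(3)]],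
      of "\<lambda>x. f x - g x" k x] assms by simp

lemma Cn_dist_eq:
  assumes "a < b" "f \<in> Cn n {a..b}" "g \<in> Cn n {a..b}"
  shows "Cn_dist n {a..b} f g =
    (\<Sum>k\<le>n. sup_norm {a..b} (\<lambda>x. deriv_within {a..b} k f x - deriv_within {a..b} k g x))"
  unfolding Cn_dist_def Cn_norm_def sup_norm_def
  by (intro sum.cong SUP_cong refl) (use assms deriv_within_diff in auto)

lemma deriv_diff_le_Cn_dist:
  assumes "a < b" "f \<in> Cn n {a..b}" "g \<in> Cn n {a..b}" "k \<le> n" "x \<in> {a..b}"
  shows "\<bar>deriv_within {a..b} k f x - deriv_within {a..b} k g x\<bar> \<le> Cn_dist n {a..b} f g"
proof -
  let ?h = "\<lambda>k x. deriv_within {a..b} k f x - deriv_within {a..b} k g x"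
  have cont: "continuous_on {a..b} (?h k)" if "k \<le> n" for k
    using assms that by (intro continuous_intros Cn_deriv_continuous)
  have "\<bar>?h k x\<bar> \<le> sup_norm {a..b} (?h k)"
    using assms by (intro abs_le_sup_norm cont) auto
  also have "\<dots> \<le> (\<Sum>k\<le>n. sup_norm {a..b} (?h k))"
    using assms by (intro member_le_sum sup_norm_nonneg cont) auto
  finally show ?thesis by (simp add: Cn_dist_eq assms)
qed

lemma Cn_dist_le:
  assumes "a < b" "f \<in> Cn n {a..b}" "g \<in> Cn n {a..b}"
    and "\<And>k x. \<lbrakk>k \<le> n; x \<in> {a..b}\<rbrakk> \<Longrightarrow> \<bar>deriv_within {a..b} k f x - deriv_within {a..b} k g x\<bar> \<le> B"
  shows "Cn_dist n {a..b} f g \<le> real (Suc n) * B"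
proof -
  have "Cn_dist n {a..b} f g \<le> (\<Sum>k\<le>n. B)"
    unfolding Cn_dist_eq[OF assms(1-3)]
    by (intro sum_mono sup_norm_le) (use assms in auto)
  then show ?thesis by simp
qed

text \<open>\<open>Cn_dist\<close> is cut off outside \<open>M\<close> because a \<open>Metric_space\<close> needs a nonnegative and symmetric
  distance on the whole type, and for functions that are not differentiable neither is guaranteed.\<close>

lemma Cn_metric_space:
  assumes "a < b" "M \<subseteq> Cn n {a..b}"
  shows "Metric_space M (\<lambda>f g. if f \<in> M \<and> g \<in> M then Cn_dist n {a..b} f g else 0)"
proof
  have Cn: "f \<in> Cn n {a..b}" if "f \<in> M" for f using assms that by auto
  have pos: "0 \<le> Cn_dist n {a..b} f g" if "f \<in> M" "g \<in> M" for f g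
    using deriv_diff_le_Cn_dist[OF assms(1) Cn[OF that(1)] Cn[OF that(2)], of 0 a] assms(1) by auto
  show "0 \<le> (if f \<in> M \<and> g \<in> M then Cn_dist n {a..b} f g else 0)" for f g
    using pos by simp
  show "(if f \<in> M \<and> g \<in> M then Cn_dist n {a..b} f g else 0) =
      (if g \<in> M \<and> f \<in> M then Cn_dist n {a..b} g f else 0)" for f g
    by (auto simp: Cn_dist_eq[OF assms(1)] Cn sup_norm_def abs_minus_commute)
  fix f g assume fg: "f \<in> M" "g \<in> M"
  have "f = g" if "Cn_dist n {a..b} f g = 0"
  proof (rule extensionalityI)
    show "f \<in> extensional {a..b}" "g \<in> extensional {a..b}"
      using Cn fg by (auto simp: Cn_def)
    show "f x = g x" if "x \<in> {a..b}" for x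
      using deriv_diff_le_Cn_dist[OF assms(1) Cn[OF fg(1)] Cn[OF fg(2)], of 0 x] that
        \<open>Cn_dist n {a..b} f g = 0\<close> by simp
  qed
  moreover have "Cn_dist n {a..b} f f = 0"
    using assms(1) by (simp add: Cn_dist_eq[OF assms(1)] Cn fg sup_norm_def)
  ultimately show "((if f \<in> M \<and> g \<in> M then Cn_dist n {a..b} f g else 0) = 0) = (f = g)"
    using fg by auto
next
  let ?D = "deriv_within {a..b}"
  fix f g h assume fgh: "f \<in> M" "g \<in> M" "h \<in> M"
  then have Cn: "f \<in> Cn n {a..b}" "g \<in> Cn n {a..b}" "h \<in> Cn n {a..b}" using assms(2) by auto
  have "sup_norm {a..b} (\<lambda>x. ?D k f x - ?D k h x)
      \<le> sup_norm {a..b} (\<lambda>x. ?D k f x - ?D k g x) + sup_norm {a..b} (\<lambda>x. ?D k g x - ?D k h x)"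
    if "k \<le> n" for k
  proof (rule sup_norm_le)
    fix x assume x: "x \<in> {a..b}"
    have "\<bar>?D k p x - ?D k q x\<bar> \<le> sup_norm {a..b} (\<lambda>x. ?D k p x - ?D k q x)"
      if "p \<in> Cn n {a..b}" "q \<in> Cn n {a..b}" for p q
      using that \<open>k \<le> n\<close> x Cn_deriv_continuous
      by (intro abs_le_sup_norm[where f = "\<lambda>x. ?D k p x - ?D k q x"] continuous_intros) auto
    from this[of f g] this[of g h] show "\<bar>?D k f x - ?D k h x\<bar>
        \<le> sup_norm {a..b} (\<lambda>x. ?D k f x - ?D k g x) + sup_norm {a..b} (\<lambda>x. ?D k g x - ?D k h x)"
      using Cn by linarith
  qed (use assms(1) in auto)
  then show "(if f \<in> M \<and> h \<in> M then Cn_dist n {a..b} f h else 0)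
      \<le> (if f \<in> M \<and> g \<in> M then Cn_dist n {a..b} f g else 0)
        + (if g \<in> M \<and> h \<in> M then Cn_dist n {a..b} g h else 0)"
    using fgh by (auto simp: Cn_dist_eq[OF assms(1)] Cn sum.distrib[symmetric] intro!: sum_mono)
qed

text \<open>Banach's theorem for a subset of \<open>C\<^sup>n[a,b]\<close> that is closed under limits of all derivatives up to
  order \<open>n\<close>. Completeness: along a Cauchy sequence each derivative converges uniformly, and by
  \<open>jet_on_uniform_limit\<close> the limits form the jet of one function.\<close>

lemma Cn_contraction_fixed_point:
  assumes ab: "a < b" and M: "M \<subseteq> Cn n {a..b}" "M \<noteq> {}"
    and closed: "\<And>\<sigma> f. \<lbrakk>\<And>j. \<sigma> j \<in> M; f \<in> Cn n {a..b};
        \<And>k x. \<lbrakk>k \<le> n; x \<in> {a..b}\<rbrakk> \<Longrightarrow> (\<lambda>j. deriv_within {a..b} k (\<sigma> j) x) \<longlonglongrightarrow> deriv_within {a..b} k f x\<rbrakk>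
      \<Longrightarrow> f \<in> M"
    and T: "T \<in> M \<rightarrow> M" "contractive_on M (Cn_dist n {a..b}) T"
  shows "\<exists>!f. f \<in> M \<and> T f = f"
proof -
  let ?D = "deriv_within {a..b}"
  let ?d = "\<lambda>f g. if f \<in> M \<and> g \<in> M then Cn_dist n {a..b} f g else 0"
  interpret Metric_space M ?d using ab M(1) by (rule Cn_metric_space)
  have Cn: "f \<in> Cn n {a..b}" if "f \<in> M" for f using M that by auto
  have mcomplete
    unfolding mcomplete_def
  proof (intro allI impI)
    fix \<sigma> assume "MCauchy \<sigma>"
    then have \<sigma>: "\<sigma> j \<in> M" for j
      by (auto simp: MCauchy_def)
    have cauchy: "\<exists>J. \<forall>i j. J \<le> i \<longrightarrow> J \<le> j \<longrightarrow> Cn_dist n {a..b} (\<sigma> i) (\<sigma> j) < e" if "e > 0" for e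
      using \<open>MCauchy \<sigma>\<close> that by (simp add: MCauchy_def \<sigma>)
    have "uniformly_convergent_on {a..b} (\<lambda>j. ?D k (\<sigma> j))" if k: "k \<le> n" for k
    proof (intro Cauchy_uniformly_convergent uniformly_Cauchy_onI)
      fix e :: real assume "e > 0"
      then obtain J where J: "\<And>i j. \<lbrakk>J \<le> i; J \<le> j\<rbrakk> \<Longrightarrow> Cn_dist n {a..b} (\<sigma> i) (\<sigma> j) < e"
        using cauchy by blast
      have "dist (?D k (\<sigma> i) x) (?D k (\<sigma> j) x) < e" if "x \<in> {a..b}" "J \<le> i" "J \<le> j" for x i j
        using deriv_diff_le_Cn_dist[OF ab Cn[OF \<sigma>[of i]] Cn[OF \<sigma>[of j]] k that(1)] J[OF that(2,3)]
        by (simp add: dist_real_def)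
      then show "\<exists>J. \<forall>x\<in>{a..b}. \<forall>i\<ge>J. \<forall>j\<ge>J. dist (?D k (\<sigma> i) x) (?D k (\<sigma> j) x) < e" by blast
    qed
    then have "\<forall>k. \<exists>G. k \<le> n \<longrightarrow> uniform_limit {a..b} (\<lambda>j. ?D k (\<sigma> j)) G sequentially"
      by (auto simp: uniformly_convergent_on_def)
    from choice[OF this] obtain G
      where G: "\<And>k. k \<le> n \<Longrightarrow> uniform_limit {a..b} (\<lambda>j. ?D k (\<sigma> j)) (G k) sequentially"
      by blast
    have jet: "jet_on n {a..b} G"
      by (rule jet_on_uniform_limit[OF convex_real_interval(5) Cn_imp_jet_on[OF Cn[OF \<sigma>]] G])
    define f where "f = restrict (G 0) {a..b}"
    have f: "f \<in> Cn n {a..b}"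
      by (rule jet_on_imp_Cn[OF jet ab]) (auto simp: f_def)
    have Df: "?D k f x = G k x" if "k \<le> n" "x \<in> {a..b}" for k x
      by (rule deriv_within_jet[OF jet ab _ that]) (auto simp: f_def)
    have fM: "f \<in> M"
    proof (rule closed[OF \<sigma> f])
      show "(\<lambda>j. ?D k (\<sigma> j) x) \<longlonglongrightarrow> ?D k f x" if "k \<le> n" "x \<in> {a..b}" for k x
        using tendsto_uniform_limitI[OF G] that by (simp add: Df)
    qed
    have "\<exists>J. \<forall>j\<ge>J. \<sigma> j \<in> M \<and> ?d (\<sigma> j) f < e" if "e > 0" for e
    proof -
      define e' where "e' = e / (2 * real (Suc n))"
      have "e' > 0" using that by (simp add: e'_def)
      have "\<forall>k\<le>n. \<forall>\<^sub>F j in sequentially. \<forall>x\<in>{a..b}. dist (?D k (\<sigma> j) x) (G k x) < e'"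
        using uniform_limitD[OF G \<open>e' > 0\<close>] by blast
      then have "\<forall>\<^sub>F j in sequentially. \<forall>k\<in>{..n}. \<forall>x\<in>{a..b}. dist (?D k (\<sigma> j) x) (G k x) < e'"
        by (subst eventually_ball_finite_distrib) auto
      then obtain J where "\<forall>j\<ge>J. \<forall>k\<in>{..n}. \<forall>x\<in>{a..b}. dist (?D k (\<sigma> j) x) (G k x) < e'"
        unfolding eventually_sequentially ..
      then have J: "\<And>j k x. \<lbrakk>J \<le> j; k \<le> n; x \<in> {a..b}\<rbrakk> \<Longrightarrow> dist (?D k (\<sigma> j) x) (G k x) < e'"
        by blast
      have "?d (\<sigma> j) f < e" if "J \<le> j" for j
      proof -
        have "Cn_dist n {a..b} (\<sigma> j) f \<le> real (Suc n) * e'"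
          by (rule Cn_dist_le[OF ab Cn[OF \<sigma>] f])
            (use J[OF that] Df in \<open>auto simp: dist_real_def intro: less_imp_le\<close>)
        also have "\<dots> = e / 2" by (simp add: e'_def del: of_nat_Suc)
        finally show ?thesis using \<open>e > 0\<close> by auto
      qed
      then show ?thesis using \<sigma> by blast
    qed
    then show "\<exists>f. limitin mtopology \<sigma> f sequentially"
      unfolding limit_metric_sequentially using fM by (intro exI[of _ f]) blast
  qed
  obtain c where c: "c < 1"
    "\<And>f g. \<lbrakk>f \<in> M; g \<in> M\<rbrakk> \<Longrightarrow> Cn_dist n {a..b} (T f) (T g) \<le> c * Cn_dist n {a..b} f g"
    using T(2) by (auto simp: contractive_on_def)
  have con: "?d (T f) (T g) \<le> c * ?d f g" if "f \<in> M" "g \<in> M" for f g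
    using c(2) that T(1) by auto
  obtain f where f: "f \<in> M" "T f = f"
    using Banach_fixedpoint_thm[OF \<open>mcomplete\<close> M(2) T(1) c(1) con] by blast
  have "g = f" if g: "g \<in> M" "T g = g" for g
  proof -
    have "(1 - c) * ?d g f \<le> 0"
      using con[OF g(1) f(1)] f g by (simp add: algebra_simps)
    then have "?d g f \<le> 0" using c(1) by (simp add: mult_le_0_iff)
    then show ?thesis using zero[OF g(1) f(1)] nonneg[of g f] by linarith
  qed
  then show ?thesis using f by blast
qed

section \<open>The contraction estimate\<close>

text \<open>Sum the \<open>n + 1\<close> hypotheses. The coefficient of \<open>a l\<close> becomes the hockey-stick sum
  \<open>\<Sum>m=l..n. (m choose l) = (n + 1) choose (l + 1) = (n + 1) / (l + 1) * (n choose l)\<close>.\<close>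

lemma weighted_average_bound:
  fixes a :: "nat \<Rightarrow> real"
  assumes "\<And>k. k \<le> n \<Longrightarrow> (\<Sum>l\<le>k. real ((n - k + l) choose l) * a l) \<le> B"
  shows "(\<Sum>l\<le>n. real (n choose l) / real (Suc l) * a l) \<le> B"
proof -
  have col: "(\<Sum>k=l..n. real ((n - k + l) choose l)) = real (Suc n choose Suc l)" if "l \<le> n" for l
  proof -
    have "(\<Sum>k=l..n. (n - k + l) choose l) = (\<Sum>m=l..n. m choose l)"
      by (rule sum.reindex_bij_witness[where i = "\<lambda>m. n - m + l" and j = "\<lambda>k. n - k + l"])
        (use that in auto)
    also have "\<dots> = (\<Sum>m\<le>n. m choose l)"
      by (rule sum.mono_neutral_left) auto
    finally show ?thesis
      by (simp only: sum_choose_upper flip: of_nat_sum)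
  qed
  have absorb: "real (Suc n choose Suc l) = real (Suc n) * (real (n choose l) / real (Suc l))" for l
    using arg_cong[OF Suc_times_binomial_eq[of n l], of real]
    by (simp add: field_simps del: binomial_Suc_Suc)
  have "real (Suc n) * (\<Sum>l\<le>n. real (n choose l) / real (Suc l) * a l)
      = (\<Sum>l\<le>n. \<Sum>k=l..n. real ((n - k + l) choose l) * a l)"
    unfolding sum_distrib_left
    by (intro sum.cong refl) (simp only: sum_distrib_right[symmetric] col absorb mult.assoc atMost_iff)
  also have "\<dots> = (\<Sum>k\<le>n. \<Sum>l\<le>k. real ((n - k + l) choose l) * a l)"
  proof -
    have "{k \<in> {..n}. l \<le> k} = {l..n}" for l by auto
    moreover have "{l \<in> {..n}. l \<le> k} = {..k}" if "k \<le> n" for k using that by auto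
    ultimately show ?thesis
      using sum.swap_restrict[of "{..n}" "{..n}" "\<lambda>l k. real ((n - k + l) choose l) * a l" "\<lambda>l k. l \<le> k"]
      by simp
  qed
  also have "\<dots> \<le> (\<Sum>k\<le>n. B)"
    using assms by (intro sum_mono) auto
  finally show ?thesis by simp
qed

text \<open>A function that vanishes at \<open>0\<close> and \<open>1\<close> and has derivative at most \<open>B\<close> is, by the mean value
  theorem, at most \<open>B * x\<close> and at most \<open>B * (1 - x)\<close> at \<open>x\<close>, hence at most \<open>B / 2\<close>.\<close>

lemma halving_by_endpoint_zeros:
  assumes jet: "jet_on n {0..1} h" and zero: "\<And>k. k \<le> n \<Longrightarrow> h k 0 = 0 \<and> h k 1 = 0"
    and "l \<le> k" "k \<le> n"
  shows "sup_norm {0..1} (h (k - l)) \<le> sup_norm {0..1} (h k) / 2 ^ l"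
  using assms(3)
proof (induction l)
  case 0
  then show ?case by simp
next
  case (Suc l)
  define m where "m = k - Suc l"
  have m: "Suc m = k - l" "m < n" using Suc.prems assms(4) by (auto simp: m_def)
  let ?B = "sup_norm {0..1} (h (Suc m))"
  have B: "\<bar>h (Suc m) x\<bar> \<le> ?B" if "x \<in> {0..1}" for x
    using that m jet by (intro abs_le_sup_norm jet_on_continuous[OF jet]) auto
  have "\<bar>h m x\<bar> \<le> ?B / 2" if x: "x \<in> {0..1}" for x
  proof -
    have "\<bar>h m x - h m e\<bar> \<le> ?B * \<bar>x - e\<bar>" if "e \<in> {0..1}" for e
      using field_differentiable_bound[of "{0..1}" "h m" "h (Suc m)" ?B x e] jet_on_deriv[OF jet m(2)] B x that
      by simp
    \<comment> \<open>adding the two bounds gives \<open>2 * \<bar>h m x\<bar> \<le> ?B\<close>\<close>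
    from this[of 0] this[of 1] have "\<bar>h m x\<bar> \<le> ?B * x" "\<bar>h m x\<bar> \<le> ?B * (1 - x)"
      using zero[of m] m x by auto
    then show ?thesis by (simp add: algebra_simps)
  qed
  then have "sup_norm {0..1} (h m) \<le> ?B / 2"
    by (intro sup_norm_le) auto
  also have "\<dots> \<le> sup_norm {0..1} (h k) / 2 ^ l / 2"
    using Suc m by (intro divide_right_mono) auto
  finally show ?case by (simp add: m_def field_simps)
qed

text \<open>The bound on \<open>H\<close> gains a factor \<open>2 ^ l \<ge> l + 1\<close> in the \<open>l\<close>-th term of the Leibniz sum,
  which brings its coefficient below the averaged one of \<open>weighted_average_bound\<close>.\<close>

lemma leibniz_contraction:
  fixes a H :: "nat \<Rightarrow> real"
  assumes a: "\<And>l. l \<le> n \<Longrightarrow> 0 \<le> a l"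
    and q: "\<And>k. k \<le> n \<Longrightarrow> 2 ^ n * (\<Sum>l\<le>k. real ((n - k + l) choose l) * a l) \<le> q"
    and H: "\<And>l. l \<le> k \<Longrightarrow> H (k - l) \<le> H k / 2 ^ l" "0 \<le> H k" and k: "k \<le> n"
  shows "2 ^ k * (\<Sum>l\<le>k. real (k choose l) * a l * H (k - l)) \<le> q * H k"
proof -
  have avg: "(\<Sum>l\<le>n. real (n choose l) / real (Suc l) * a l) \<le> q / 2 ^ n"
    using q by (intro weighted_average_bound) (simp add: field_simps)
  have "(\<Sum>l\<le>k. real (k choose l) * a l * H (k - l))
      \<le> (\<Sum>l\<le>k. real (n choose l) / real (Suc l) * a l * H k)"
  proof (rule sum_mono)
    fix l assume "l \<in> {..k}"
    then have l: "l \<le> k" by simp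
    have "real (k choose l) * a l * H (k - l) \<le> real (k choose l) * a l * (H k / 2 ^ l)"
      using l k a H(1) by (intro mult_left_mono) auto
    also have "\<dots> = real (k choose l) / 2 ^ l * (a l * H k)" by simp
    also have "\<dots> \<le> real (n choose l) / real (Suc l) * (a l * H k)"
    proof (intro mult_right_mono frac_le)
      have "Suc l \<le> 2 ^ l" by (metis Suc_leI less_exp)
      then show "real (Suc l) \<le> 2 ^ l" by (metis of_nat_le_iff of_nat_numeral of_nat_power)
      show "real (k choose l) \<le> real (n choose l)" using k by (simp add: binomial_right_mono)
    qed (use l k a H in auto)
    finally show "real (k choose l) * a l * H (k - l) \<le> real (n choose l) / real (Suc l) * a l * H k"
      by (simp add: mult.assoc)
  qed
  also have "\<dots> \<le> (\<Sum>l\<le>n. real (n choose l) / real (Suc l) * a l * H k)"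
    using a H k by (intro sum_mono2) auto
  also have "\<dots> = (\<Sum>l\<le>n. real (n choose l) / real (Suc l) * a l) * H k"
    by (simp only: sum_distrib_right)
  finally have "2 ^ k * (\<Sum>l\<le>k. real (k choose l) * a l * H (k - l))
      \<le> 2 ^ k * ((\<Sum>l\<le>n. real (n choose l) / real (Suc l) * a l) * H k)"
    by simp
  also have "\<dots> \<le> 2 ^ n * ((\<Sum>l\<le>n. real (n choose l) / real (Suc l) * a l) * H k)"
    using k a H by (intro mult_right_mono power_increasing mult_nonneg_nonneg sum_nonneg) auto
  also have "\<dots> \<le> 2 ^ n * (q / 2 ^ n * H k)"
    using avg H by (intro mult_left_mono mult_right_mono) auto
  finally show ?thesis by simp
qed

section \<open>The operator on one piece\<close>

lemma u_affine: "u N i x = x / 2 + u N i 0"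
  by (simp add: u_def Let_def)

lemma X_Icc:
  assumes "N > 0"
  obtains a b where "X N i = {a..b}" "a < b"
proof
  show "X N i = {2 * (real ((i + 1) div 2) - 1) / real N..2 * real ((i + 1) div 2) / real N}"
    by (simp add: X_def Let_def)
qed (use assms in \<open>simp add: divide_strict_right_mono\<close>)

lemma X_subset_unit:
  assumes "even N" "i \<in> {1..N}"
  shows "X N i \<subseteq> {0..1}"
proof -
  have "1 \<le> (i + 1) div 2" "2 * ((i + 1) div 2) \<le> N"
    using assms by (auto elim!: evenE)
  then have "1 \<le> real ((i + 1) div 2)" "2 * real ((i + 1) div 2) \<le> real N"
    by linarith+
  then have "0 \<le> 2 * (real ((i + 1) div 2) - 1) / real N" "2 * real ((i + 1) div 2) / real N \<le> 1"
    using assms(2) by (auto simp: divide_le_eq)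
  then show ?thesis
    unfolding X_def Let_def atLeastatMost_subset_iff by blast
qed

lemma unit_interval_cover:
  assumes "N > 0" "t \<in> {0..1}"
  obtains i x where "i \<in> {1..N}" "x \<in> X N i" "t = u N i x"
proof -
  define i where "i = max 1 (nat \<lceil>real N * t\<rceil>)"
  have "real N * t \<le> real N" using assms by (simp add: mult_left_le)
  then have iN: "i \<in> {1..N}"
    using assms(1) by (auto simp: i_def ceiling_le_iff)
  have "real i - 1 \<le> real N * t" "real N * t \<le> real i"
    using assms(2) by (auto simp: i_def max_def split: if_splits) linarith+
  then have "t \<in> {knot N (i - 1)..knot N i}"
    using assms(1) iN by (auto simp: knot_def field_simps of_nat_diff)
  then have "t \<in> u N i ` X N i"
    using u_image_X[of N i] assms(1) iN by simp
  then show ?thesis using that iN by blast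
qed

lemma Phi_piece_u:
  assumes "x \<in> X N i"
  shows "Phi_piece N lam S f i (u N i x) = lam i x + S i x * f x"
proof -
  have "inj_on (u N i) (X N i)"
    by (rule inj_onI) (metis u_affine add_right_cancel divide_cancel_right zero_neq_numeral)
  then show ?thesis using assms by (simp add: Phi_piece_def Let_def)
qed

text \<open>The jet of \<open>lam i + S i * f\<close> on \<open>X N i\<close>, before the change of variable by \<open>u N i\<close>.\<close>

definition source_jet ::
  "nat \<Rightarrow> (nat \<Rightarrow> real \<Rightarrow> real) \<Rightarrow> (nat \<Rightarrow> real \<Rightarrow> real) \<Rightarrow> (real \<Rightarrow> real) \<Rightarrow> nat \<Rightarrow> nat \<Rightarrow> real \<Rightarrow> real" where
  "source_jet N lam S f i k x = deriv_within (X N i) k (lam i) x +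
     leibniz (\<lambda>l. deriv_within (X N i) l (S i)) (\<lambda>l. deriv_within {0..1} l f) k x"

text \<open>The inverse of \<open>u N i\<close> is affine of slope \<open>2\<close>, whence the factor \<open>2 ^ k\<close>.\<close>

lemma Phi_piece_jet:
  assumes "N > 0" "even N" "i \<in> {1..N}" "lam i \<in> Cn n (X N i)" "S i \<in> Cn n (X N i)" "f \<in> Cn n {0..1}"
  shows "jet_on n (u N i ` X N i) (\<lambda>k. deriv_within (u N i ` X N i) k (Phi_piece N lam S f i))" (is "?jet")
    and "\<And>k x. \<lbrakk>k \<le> n; x \<in> X N i\<rbrakk> \<Longrightarrow>
      deriv_within (u N i ` X N i) k (Phi_piece N lam S f i) (u N i x) = 2 ^ k * source_jet N lam S f i k x"
proof -
  let ?I = "u N i ` X N i"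
  have I: "?I = {knot N (i - 1)..knot N i}" "knot N (i - 1) < knot N i"
    using u_image_X[of N i] assms(1,3) by (auto simp: knot_def divide_strict_right_mono)
  let ?E = "\<lambda>k t. 2 ^ k * source_jet N lam S f i k (2 * t + - 2 * u N i 0)"
  have u_inverse: "2 * u N i x + - 2 * u N i 0 = x" for x
    by (simp add: u_affine[of N i x])
  have "jet_on n (X N i) (source_jet N lam S f i)"
    unfolding source_jet_def[abs_def]
    using Cn_imp_jet_on[OF assms(4)] Cn_imp_jet_on[OF assms(5)] Cn_imp_jet_on[OF assms(6)] X_subset_unit[OF assms(2,3)]
    by (intro jet_on_add jet_on_mult) (auto intro: jet_on_subset)
  then have E: "jet_on n ?I ?E"
    by (rule jet_on_affine) (use u_inverse in auto)
  have 0: "Phi_piece N lam S f i t = ?E 0 t" if t: "t \<in> ?I" for t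
  proof -
    obtain x where "x \<in> X N i" "t = u N i x" using t by blast
    then show ?thesis
      by (simp only: Phi_piece_u u_inverse) (simp add: source_jet_def leibniz_def)
  qed
  have D: "deriv_within ?I k (Phi_piece N lam S f i) t = ?E k t" if "k \<le> n" "t \<in> ?I" for k t
    using deriv_within_jet[OF E[unfolded I] I(2) 0[unfolded I] that[unfolded I]] by (simp only: I)
  show ?jet
    by (rule jet_on_cong[OF E]) (simp only: D)
  show "deriv_within ?I k (Phi_piece N lam S f i) (u N i x) = 2 ^ k * source_jet N lam S f i k x"
    if "k \<le> n" "x \<in> X N i" for k x
    using D[OF that(1), of "u N i x"] that(2) by (simp only: u_inverse imageI)
qed

section \<open>Gluing the pieces\<close>

lemma Phi_eq_unique:
  assumes "N > 0" "Phi_eq N lam S f g" "Phi_eq N lam S f g'"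
  shows "g = g'"
proof (rule extensionalityI[of _ "{0..1}"])
  fix t :: real assume "t \<in> {0..1}"
  then obtain i x where "i \<in> {1..N}" "x \<in> X N i" "t = u N i x"
    by (rule unit_interval_cover[OF assms(1)])
  then show "g t = g' t" using assms(2,3) by (simp add: Phi_eq_def)
qed (use assms in \<open>auto simp: Phi_eq_def\<close>)

text \<open>At an interior knot the two pieces that meet there have the same derivatives up to order \<open>n\<close>,
  so for each \<open>k\<close> the \<open>k\<close>-th derivatives of the pieces form a single function on \<open>[0,1]\<close>. These
  functions are a jet on every piece, hence on \<open>[0,1]\<close>. The case \<open>k = 0\<close> is the well-definedness
  of \<open>\<Phi> f\<close>.\<close>

lemma Phi_glue:
  assumes N: "N > 0" "even N"
    and lam: "\<forall>i\<in>{1..N}. lam i \<in> Cn n (X N i)" and S: "\<forall>i\<in>{1..N}. S i \<in> Cn n (X N i)"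
    and f: "f \<in> Cn n {0..1}"
    and compat: "\<And>k m. \<lbrakk>k \<le> n; 1 \<le> m; m < N\<rbrakk> \<Longrightarrow> DPhi_left N lam S k f m = DPhi_right N lam S k f m"
  shows "\<exists>g\<in>Cn n {0..1}. Phi_eq N lam S f g \<and> (\<forall>i\<in>{1..N}. \<forall>k\<le>n. \<forall>t\<in>u N i ` X N i.
      deriv_within {0..1} k g t = deriv_within (u N i ` X N i) k (Phi_piece N lam S f i) t)"
proof -
  let ?E = "\<lambda>i k. deriv_within (u N i ` X N i) k (Phi_piece N lam S f i)"
  have I: "u N i ` X N i = {knot N (i - 1)..knot N i}" if "i \<in> {1..N}" for i
    using u_image_X[of N i] N that by simp
  have mono: "mono (knot N)"
    by (auto simp: mono_def knot_def divide_right_mono)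
  have ends: "knot N 0 = 0" "knot N N = 1" using N by (auto simp: knot_def)
  have "\<forall>k. \<exists>G. k \<le> n \<longrightarrow> (\<forall>i\<in>{1..N}. \<forall>t\<in>{knot N (i - 1)..knot N i}. G t = ?E i k t)"
  proof
    fix k
    have "?E m k (knot N m) = ?E (Suc m) k (knot N m)" if "k \<le> n" "1 \<le> m" "m < N" for m
      using compat[OF that] by (simp add: DPhi_left_def DPhi_right_def)
    then show "\<exists>G. k \<le> n \<longrightarrow> (\<forall>i\<in>{1..N}. \<forall>t\<in>{knot N (i - 1)..knot N i}. G t = ?E i k t)"
      using glue_pieces[OF mono, of N "\<lambda>i. ?E i k"] by simp
  qed
  from choice[OF this] obtain G
    where G: "\<And>k i t. \<lbrakk>k \<le> n; i \<in> {1..N}; t \<in> {knot N (i - 1)..knot N i}\<rbrakk> \<Longrightarrow> G k t = ?E i k t"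
    by blast
  have "jet_on n {knot N (i - 1)..knot N i} G" if i: "i \<in> {1..N}" for i
  proof -
    have "jet_on n {knot N (i - 1)..knot N i} (?E i)"
      using Phi_piece_jet(1)[of N i lam n S f] N i lam S f I[OF i] by simp
    then show ?thesis by (rule jet_on_cong) (use G i in auto)
  qed
  from jet_on_join_many[OF mono N(1) this] have jet: "jet_on n {0..1} G"
    by (simp add: ends)
  define g where "g = restrict (G 0) {0..1}"
  have DG: "deriv_within {0..1} k g t = G k t" if "k \<le> n" "t \<in> {0..1}" for k t
    by (rule deriv_within_jet[OF jet _ _ that]) (auto simp: g_def)
  have unit: "{knot N (i - 1)..knot N i} \<subseteq> {0..1}" if "i \<in> {1..N}" for i
    using monoD[OF mono, of 0 "i - 1"] monoD[OF mono, of i N] that ends by auto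
  have *: "deriv_within {0..1} k g t = ?E i k t" if "i \<in> {1..N}" "k \<le> n" "t \<in> u N i ` X N i" for i k t
  proof -
    have t: "t \<in> {knot N (i - 1)..knot N i}" using that(3) unfolding I[OF that(1)] .
    then have "t \<in> {0..1}" using unit[OF that(1)] by blast
    then show ?thesis using DG[OF that(2)] G[OF that(2,1) t] by simp
  qed
  have "g \<in> Cn n {0..1}"
    by (rule jet_on_imp_Cn[OF jet]) (auto simp: g_def)
  moreover have "Phi_eq N lam S f g"
    unfolding Phi_eq_def
  proof (intro conjI ballI)
    fix i x assume "i \<in> {1..N}" "x \<in> X N i"
    then show "g (u N i x) = lam i x + S i x * f x"
      using *[of i 0 "u N i x"] by (simp add: Phi_piece_u)
  qed (simp add: g_def)
  ultimately show ?thesis using * by blast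
qed

lemma Phi_properties:
  assumes "N > 0" "even N"
    and "\<forall>i\<in>{1..N}. lam i \<in> Cn n (X N i)" "\<forall>i\<in>{1..N}. S i \<in> Cn n (X N i)"
    and "f \<in> Cn n {0..1}"
    and "\<And>k m. \<lbrakk>k \<le> n; 1 \<le> m; m < N\<rbrakk> \<Longrightarrow> DPhi_left N lam S k f m = DPhi_right N lam S k f m"
  shows "\<exists>!g. Phi_eq N lam S f g" and "Phi N lam S f \<in> Cn n {0..1}"
    and "\<And>i k t. \<lbrakk>i \<in> {1..N}; k \<le> n; t \<in> u N i ` X N i\<rbrakk> \<Longrightarrow>
      deriv_within {0..1} k (Phi N lam S f) t = deriv_within (u N i ` X N i) k (Phi_piece N lam S f i) t"
proof -
  obtain g where g: "Phi_eq N lam S f g" "g \<in> Cn n {0..1}"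
    "\<And>i k t. \<lbrakk>i \<in> {1..N}; k \<le> n; t \<in> u N i ` X N i\<rbrakk> \<Longrightarrow>
      deriv_within {0..1} k g t = deriv_within (u N i ` X N i) k (Phi_piece N lam S f i) t"
    using Phi_glue[OF assms] by blast
  have uniq: "g' = g" if "Phi_eq N lam S f g'" for g'
    using Phi_eq_unique[OF assms(1) that g(1)] .
  show "\<exists>!g. Phi_eq N lam S f g"
    using g(1) uniq by (rule ex1I)
  have Phi: "Phi N lam S f = g"
    unfolding Phi_def using g(1) uniq by (rule the_equality)
  show "Phi N lam S f \<in> Cn n {0..1}"
    using g(2) unfolding Phi .
  show "deriv_within {0..1} k (Phi N lam S f) t = deriv_within (u N i ` X N i) k (Phi_piece N lam S f i) t"
    if "i \<in> {1..N}" "k \<le> n" "t \<in> u N i ` X N i" for i k t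
    unfolding Phi using that by (rule g(3))
qed

lemma Cn_interp_nonempty:
  assumes "N > 0"
  shows "Cn_interp n N y \<noteq> {}"
proof -
  have "inj (\<lambda>j. knot N (2 * j))"
    using assms by (auto simp: inj_def knot_def)
  from hermite_interpolation[OF this, of "Suc (N div 2)" "Suc n" y]
  obtain P where P: "\<And>j k. \<lbrakk>j \<le> N div 2; k \<le> n\<rbrakk> \<Longrightarrow> poly ((pderiv ^^ k) P) (knot N (2 * j)) = y j k"
    by (auto simp: less_Suc_eq_le)
  define f where "f = restrict (poly P) {0..1}"
  have "f \<in> Cn n {0..1}"
    by (rule jet_on_imp_Cn[OF jet_on_poly]) (auto simp: f_def)
  moreover have "deriv_within {0..1} k f x = poly ((pderiv ^^ k) P) x" if "k \<le> n" "x \<in> {0..1}" for k x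
    by (rule deriv_within_jet[OF jet_on_poly _ _ that]) (auto simp: f_def)
  moreover have "knot N (2 * j) \<in> {0..1}" if "j \<le> N div 2" for j
    using that assms by (auto simp: knot_def field_simps)
  ultimately have "f \<in> Cn_interp n N y"
    using P by (auto simp: Cn_interp_def)
  then show ?thesis by blast
qed

section \<open>The self-map, its contractivity and its fixed point\<close>

text \<open>At an odd knot this is the matching condition; at an even one both one-sided values are the
  prescribed \<open>y j k\<close>, the right-hand one by the condition for the next index.\<close>

lemma knots_compatible:
  assumes "even N"
    and H: "\<forall>j\<in>{1..N div 2}.
      y (j - 1) k = DPhi_right N lam S k f (2 * (j - 1)) \<and>
      y j k = DPhi_left N lam S k f (2 * j) \<and>
      DPhi_left N lam S k f (2 * j - 1) = DPhi_right N lam S k f (2 * j - 1)"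
    and m: "1 \<le> m" "m < N"
  shows "DPhi_left N lam S k f m = DPhi_right N lam S k f m"
proof (cases "even m")
  case True
  then obtain j where j: "m = 2 * j" by blast
  then have "j \<in> {1..N div 2}" "Suc j \<in> {1..N div 2}"
    using m assms(1) by (auto elim!: evenE)
  then show ?thesis
    using bspec[OF H, of j] bspec[OF H, of "Suc j"] j by simp
next
  case False
  then obtain j where j: "m = 2 * j + 1" by (rule oddE)
  then have "Suc j \<in> {1..N div 2}"
    using m assms(1) by (auto elim!: evenE)
  then show ?thesis using bspec[OF H, of "Suc j"] j by simp
qed

theorem theorem10:
  fixes n N :: nat
    and y :: "nat \<Rightarrow> nat \<Rightarrow> real"
    and lam S :: "nat \<Rightarrow> real \<Rightarrow> real"
  assumes "N > 0" and "even N"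
    and "\<forall>i\<in>{1..N}. lam i \<in> Cn n (X N i)"
    and "\<forall>i\<in>{1..N}. S i \<in> Cn n (X N i)"
    and "\<forall>f\<in>Cn_interp n N y. \<forall>k\<le>n. \<forall>j\<in>{1..N div 2}.
           y (j - 1) k = DPhi_right N lam S k f (2 * (j - 1)) \<and>
           y j k = DPhi_left N lam S k f (2 * j) \<and>
           DPhi_left N lam S k f (2 * j - 1) = DPhi_right N lam S k f (2 * j - 1)"
  shows "(\<forall>f\<in>Cn_interp n N y. \<exists>!g. Phi_eq N lam S f g) \<and>
         (\<forall>f\<in>Cn_interp n N y. Phi N lam S f \<in> Cn_interp n N y) \<and>
         (2 ^ n * (MAX i\<in>{1..N}. MAX k\<in>{..n}. \<Sum>l\<le>k.
              real ((n - k + l) choose l) * sup_norm (X N i) (deriv_within (X N i) l (S i))) < 1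
          \<longrightarrow> contractive_on (Cn_interp n N y) (Cn_dist n {0..1}) (Phi N lam S) \<and>
              (\<exists>!f. f \<in> Cn_interp n N y \<and> Phi N lam S f = f))"
proof -
  let ?M = "Cn_interp n N y"
  let ?D = "deriv_within {0..1}"
  let ?P = "Phi N lam S"
  let ?a = "\<lambda>i l. sup_norm (X N i) (deriv_within (X N i) l (S i))"
  let ?c = "\<lambda>i k. \<Sum>l\<le>k. real ((n - k + l) choose l) * ?a i l"
  define q where "q = 2 ^ n * (MAX i\<in>{1..N}. MAX k\<in>{..n}. ?c i k)"
  have Cn: "f \<in> Cn n {0..1}" if "f \<in> ?M" for f
    using that by (simp add: Cn_interp_def)
  have val: "?D k f (knot N (2 * j)) = y j k" if "f \<in> ?M" "k \<le> n" "j \<le> N div 2" for f k j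
    using that by (simp add: Cn_interp_def)
  have compat: "DPhi_left N lam S k f m = DPhi_right N lam S k f m"
    if "f \<in> ?M" "k \<le> n" "1 \<le> m" "m < N" for f k m
    using knots_compatible[OF assms(2) _ that(3,4), of y k lam S f] assms(5) that(1,2) by blast
  have ex1: "\<exists>!g. Phi_eq N lam S f g" and P_Cn: "?P f \<in> Cn n {0..1}"
    and P_deriv: "\<And>i k t. \<lbrakk>i \<in> {1..N}; k \<le> n; t \<in> u N i ` X N i\<rbrakk> \<Longrightarrow>
      ?D k (?P f) t = deriv_within (u N i ` X N i) k (Phi_piece N lam S f i) t" if "f \<in> ?M" for f
    using Phi_properties[OF assms(1-4) Cn[OF that] compat[OF that]] by blast+
  have knot_mem: "knot N i \<in> u N i ` X N i" "knot N (i - 1) \<in> u N i ` X N i" if "i \<in> {1..N}" for i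
    using u_image_X[of N i] that assms(1) by (auto simp: knot_def divide_right_mono)
  have P_M: "?P f \<in> ?M" if f: "f \<in> ?M" for f
  proof -
    \<comment> \<open>no piece ends at knot \<open>0\<close>, so its value comes from the right-hand condition for \<open>j = 1\<close>\<close>
    have "?D k (?P f) (knot N (2 * j)) = y j k" if k: "k \<le> n" and j: "j \<le> N div 2" for k j
    proof (cases "j = 0")
      case True
      have 1: "1 \<in> {1..N div 2}" "1 \<in> {1..N}" using assms(1,2) by (auto elim!: evenE)
      have "y 0 k = DPhi_right N lam S k f 0"
        using assms(5) f k 1(1) by force
      then show ?thesis
        using P_deriv[OF f 1(2) k knot_mem(2)[OF 1(2)]] True by (simp add: DPhi_right_def)
    next
      case False
      then have 1: "j \<in> {1..N div 2}" "2 * j \<in> {1..N}" using j assms(2) by (auto elim!: evenE)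
      have "y j k = DPhi_left N lam S k f (2 * j)"
        using assms(5) f k 1(1) by blast
      then show ?thesis
        using P_deriv[OF f 1(2) k knot_mem(1)[OF 1(2)]] by (simp add: DPhi_left_def)
    qed
    then show ?thesis using P_Cn[OF f] by (simp add: Cn_interp_def)
  qed
  have contr: "contractive_on ?M (Cn_dist n {0..1}) ?P" if "q < 1"
  proof -
    have cont_S: "continuous_on (X N i) (deriv_within (X N i) l (S i))" if "i \<in> {1..N}" "l \<le> n" for i l
      using assms(4) that by (intro Cn_deriv_continuous) auto
    have X: "compact (X N i)" "X N i \<noteq> {}" for i
      by (rule X_Icc[OF assms(1), of i]; simp)+
    have a_nonneg: "0 \<le> ?a i l" if "i \<in> {1..N}" "l \<le> n" for i l
      using that by (intro sup_norm_nonneg X cont_S)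
    have c_le: "2 ^ n * ?c i k \<le> q" if "i \<in> {1..N}" "k \<le> n" for i k
    proof -
      have "?c i k \<le> (MAX k\<in>{..n}. ?c i k)"
        using that by (intro Max_ge) auto
      also have "\<dots> \<le> (MAX i\<in>{1..N}. MAX k\<in>{..n}. ?c i k)"
        using that by (intro Max_ge) auto
      finally show ?thesis by (simp add: q_def)
    qed
    have "1 \<in> {1..N}" using assms(1) by simp
    then have "0 \<le> 2 ^ n * ?c 1 0" "2 ^ n * ?c 1 0 \<le> q"
      using a_nonneg[of 1 0] c_le[of 1 0] by auto
    then have "0 \<le> q" by (rule order_trans)
    moreover have "Cn_dist n {0..1} (?P f) (?P g) \<le> q * Cn_dist n {0..1} f g" if f: "f \<in> ?M" and g: "g \<in> ?M" for f g
    proof -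
      define h where "h k x = ?D k f x - ?D k g x" for k x
      define H where "H k = sup_norm {0..1} (h k)" for k
      have jet_h: "jet_on n {0..1} h"
        unfolding h_def[abs_def] by (intro jet_on_diff Cn_imp_jet_on Cn f g)
      have h_le: "\<bar>h k x\<bar> \<le> H k" if "k \<le> n" "x \<in> {0..1}" for k x
        unfolding H_def by (intro abs_le_sup_norm jet_on_continuous[OF jet_h] that) auto
      have H_nonneg: "0 \<le> H k" if "k \<le> n" for k
        using h_le[OF that, of 0] by simp
      \<comment> \<open>\<open>0\<close> and \<open>1\<close> are the even knots with indices \<open>0\<close> and \<open>N\<close>\<close>
      have "h k 0 = 0 \<and> h k 1 = 0" if "k \<le> n" for k
        using val[OF f that, of 0] val[OF g that, of 0]
          val[OF f that, of "N div 2"] val[OF g that, of "N div 2"] assms(1,2)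
        by (simp add: h_def knot_def)
      note H_half = halving_by_endpoint_zeros[OF jet_h this, folded H_def]
      have "sup_norm {0..1} (\<lambda>t. ?D k (?P f) t - ?D k (?P g) t) \<le> q * H k" if k: "k \<le> n" for k
      proof (rule sup_norm_le)
        fix t :: real assume "t \<in> {0..1}"
        then obtain i x where i: "i \<in> {1..N}" and x: "x \<in> X N i" and t: "t = u N i x"
          by (rule unit_interval_cover[OF assms(1)])
        have x01: "x \<in> {0..1}" using X_subset_unit[OF assms(2) i] x by blast
        have "?D k (?P p) t = 2 ^ k * source_jet N lam S p i k x" if "p \<in> ?M" for p
          using P_deriv[OF that i k, of t] Phi_piece_jet(2)[OF assms(1,2) i _ _ Cn[OF that] k x] assms(3,4) i x t
          by simp
        moreover have "leibniz (\<lambda>l. deriv_within (X N i) l (S i)) (\<lambda>l. ?D l f) k x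
            - leibniz (\<lambda>l. deriv_within (X N i) l (S i)) (\<lambda>l. ?D l g) k x
            = (\<Sum>l\<le>k. real (k choose l) * deriv_within (X N i) l (S i) x * h (k - l) x)"
          by (simp add: leibniz_def h_def right_diff_distrib sum_subtractf)
        ultimately have "?D k (?P f) t - ?D k (?P g) t =
            2 ^ k * (\<Sum>l\<le>k. real (k choose l) * deriv_within (X N i) l (S i) x * h (k - l) x)"
          using f g by (simp add: source_jet_def flip: right_diff_distrib)
        then have "\<bar>?D k (?P f) t - ?D k (?P g) t\<bar> =
            2 ^ k * \<bar>\<Sum>l\<le>k. real (k choose l) * deriv_within (X N i) l (S i) x * h (k - l) x\<bar>"
          by (simp add: abs_mult)
        also have "\<dots> \<le> 2 ^ k * (\<Sum>l\<le>k. real (k choose l) * ?a i l * H (k - l))"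
        proof (intro mult_left_mono order_trans[OF sum_abs] sum_mono)
          fix l assume "l \<in> {..k}"
          then have l: "l \<le> k" "l \<le> n" using k by auto
          have "\<bar>deriv_within (X N i) l (S i) x\<bar> \<le> ?a i l"
            by (rule abs_le_sup_norm[OF X(1) cont_S[OF i l(2)] x])
          moreover have "\<bar>h (k - l) x\<bar> \<le> H (k - l)"
            using h_le[of "k - l" x] k x01 by simp
          ultimately have "\<bar>deriv_within (X N i) l (S i) x\<bar> * \<bar>h (k - l) x\<bar> \<le> ?a i l * H (k - l)"
            by (rule mult_mono) (use a_nonneg[OF i l(2)] in simp_all)
          then show "\<bar>real (k choose l) * deriv_within (X N i) l (S i) x * h (k - l) x\<bar>
              \<le> real (k choose l) * ?a i l * H (k - l)"
            by (simp add: abs_mult mult.assoc mult_left_mono)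
        qed simp
        also have "\<dots> \<le> q * H k"
          by (rule leibniz_contraction[OF a_nonneg[OF i] c_le[OF i] H_half H_nonneg[OF k] k]) (use k in auto)
        finally show "\<bar>?D k (?P f) t - ?D k (?P g) t\<bar> \<le> q * H k" .
      qed auto
      then have "(\<Sum>k\<le>n. sup_norm {0..1} (\<lambda>t. ?D k (?P f) t - ?D k (?P g) t)) \<le> (\<Sum>k\<le>n. q * H k)"
        by (intro sum_mono) auto
      then show ?thesis
        using P_Cn[OF f] P_Cn[OF g] Cn[OF f] Cn[OF g]
        by (simp add: Cn_dist_eq sum_distrib_left H_def h_def[abs_def])
    qed
    ultimately show ?thesis
      using that by (auto simp: contractive_on_def)
  qed
  have fixed: "\<exists>!f. f \<in> ?M \<and> ?P f = f" if "q < 1"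
  proof (rule Cn_contraction_fixed_point[where a = 0 and b = 1 and n = n])
    show "?M \<subseteq> Cn n {0..1}" using Cn by blast
    show "?M \<noteq> {}" using assms(1) by (rule Cn_interp_nonempty)
    show "?P \<in> ?M \<rightarrow> ?M" using P_M by blast
    show "contractive_on ?M (Cn_dist n {0..1}) ?P" using that by (rule contr)
    fix \<sigma> f
    assume \<sigma>: "\<And>j. \<sigma> j \<in> ?M" and f: "f \<in> Cn n {0..1}"
      and lim: "\<And>k x. \<lbrakk>k \<le> n; x \<in> {0..1}\<rbrakk> \<Longrightarrow> (\<lambda>j. ?D k (\<sigma> j) x) \<longlonglongrightarrow> ?D k f x"
    have "?D k f (knot N (2 * j)) = y j k" if "k \<le> n" "j \<le> N div 2" for k j
    proof (rule LIMSEQ_unique)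
      have "knot N (2 * j) \<in> {0..1}"
        using that(2) assms(1) by (auto simp: knot_def field_simps)
      then show "(\<lambda>i. ?D k (\<sigma> i) (knot N (2 * j))) \<longlonglongrightarrow> ?D k f (knot N (2 * j))"
        by (rule lim[OF that(1)])
      show "(\<lambda>i. ?D k (\<sigma> i) (knot N (2 * j))) \<longlonglongrightarrow> y j k"
        by (simp add: val[OF \<sigma> that])
    qed
    then show "f \<in> ?M" using f by (simp add: Cn_interp_def)
  qed simp
  show ?thesis
    unfolding q_def[symmetric] using ex1 P_M contr fixed by blast
qed

end
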